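(* Let $p\neq 5$ be an odd prime, and let $\alpha_p$ be the integer with $1\le \alpha_p\le 4$ and $\alpha_p p\equiv 1 \pmod 5$. Then, in the polynomial ring $\mathbb{Z}[q]$, $$\widehat{\mathcal{F}}_{p-1}(q)\equiv \tfrac12\Big(1-\Big(\tfrac{5}{p}\Big)\Big)\pmod{[p]_q}$$ and $$\widehat{\mathcal{F}}_{p}(q)\equiv \Big(\tfrac{5}{p}\Big)\, q^{(\alpha_p p-1)/5}\pmod{[p]_q}.$$
   Context: The $q$-Fibonacci polynomials $\widehat{\mathcal{F}}_n(q)$ (Schur) are defined by $\widehat{\mathcal{F}}_0(q)=0$, $\widehat{\mathcal{F}}_1(q)=1$, and $\widehat{\mathcal{F}}_n(q)=\widehat{\mathcal{F}}_{n-1}(q)+q^{n-1}\widehat{\mathcal{F}}_{n-2}(q)$ for $n\ge 2$. For a non-negative integer $n$, $[n]_q=\frac{1-q^n}{1-q}=1+q+\cdots+q^{n-1}$. $\big(\tfrac{\cdot}{p}\big)$ denotes the Legendre symbol. A congruence $f\equiv g\pmod{h}$ of polynomials means $h$ divides $f-g$ in $\mathbb{Z}[q]$. *)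

theory Defs
  imports
    "HOL-Computational_Algebra.Polynomial"
    "HOL-Number_Theory.Number_Theory"
begin

fun schur_fib :: "nat \<Rightarrow> int poly" where
  "schur_fib 0 = 0"
| "schur_fib (Suc 0) = 1"
| "schur_fib (Suc (Suc n)) = schur_fib (Suc n) + Polynomial.monom 1 (Suc n) * schur_fib n"

definition q_int :: "nat \<Rightarrow> int poly" where
  "q_int n = (\<Sum>i<n. Polynomial.monom 1 i)"

lemma q_int_geometric: "q_int n * (1 - Polynomial.monom 1 1) = 1 - Polynomial.monom 1 n"
proof (induction n)
  case 0
  show ?case by (simp add: q_int_def)
next
  case (Suc n)
  have "q_int (Suc n) * (1 - Polynomial.monom 1 1)
      = q_int n * (1 - Polynomial.monom 1 1) + Polynomial.monom 1 n * (1 - Polynomial.monom 1 1)"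
    by (simp add: q_int_def algebra_simps)
  also have "\<dots> = 1 - Polynomial.monom 1 n + (Polynomial.monom 1 n - Polynomial.monom 1 (Suc n))"
    unfolding Suc.IH by (simp add: right_diff_distrib Polynomial.mult_monom)
  finally show ?case by simp
qed

(* Congruence in the ring of integer polynomials. The library's cong is defined through mod,
   which int poly does not have, since it is not a Euclidean ring. *)
definition poly_cong :: "int poly \<Rightarrow> int poly \<Rightarrow> int poly \<Rightarrow> bool" where
  "poly_cong f g h \<longleftrightarrow> h dvd (f - g)"

end

(* The proof rests on Schur's finite Rogers-Ramanujan identity
     F_n = sum_j (-1)^j q^(j(5j-3)/2) [n choose floor((n+2-5j)/2)]_q,
   with j ranging over the integers: by the two q-Pascal rules both sides satisfy the same
   recurrence, up to a telescoping sum. For a prime p every [p choose k]_q with 0 < k < p is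
   divisible by [p]_q, so modulo [p]_q only the j whose lower index is 0 or p survive. For F_p
   there is exactly one such j. For F_(p-1), q^p = 1 modulo [p]_q gives F_(p-1) = F_(p+1) - F_p,
   and the q-Pascal rules turn this difference into a sum over [p choose k]_q again, with at most
   one surviving j. Writing p = 10m + r makes the exponents explicit; quadratic reciprocity
   identifies the sign. *)
theory Submission
  imports Defs
begin

section \<open>Gaussian binomials and the two q-Pascal rules\<close>

text \<open>The lower index is an integer, so the floor in Schur's sum can be used as it stands,
  even when negative or above \<open>n\<close>. For negative \<open>k\<close> the factor
  \<open>x ^ nat k\<close> is 1, which is harmless because it multiplies 0.\<close>

fun qbinom :: "'a::comm_ring_1 \<Rightarrow> nat \<Rightarrow> int \<Rightarrow> 'a" where
  "qbinom x 0 k = (if k = 0 then 1 else 0)"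
| "qbinom x (Suc n) k = qbinom x n (k - 1) + x ^ nat k * qbinom x n k"

lemma qbinom_eq_0: "k < 0 \<or> int n < k \<Longrightarrow> qbinom x n k = 0"
  by (induction n arbitrary: k) auto

lemma qbinom_0 [simp]: "qbinom x n 0 = 1"
  by (induction n) (auto simp: qbinom_eq_0)

lemma qbinom_self [simp]: "qbinom x n (int n) = 1"
  by (induction n) (auto simp: qbinom_eq_0)

(* Exponents written with nat are only right when the q-binomial does not vanish. *)
lemma power_mult_qbinom:
  assumes "0 \<le> k \<Longrightarrow> k \<le> int n \<Longrightarrow> a = b"
  shows "x ^ a * qbinom x n k = x ^ b * qbinom x n k"
proof (cases "0 \<le> k \<and> k \<le> int n")
  case True
  then show ?thesis using assms by simp
next
  case False
  then show ?thesis by (simp add: qbinom_eq_0 not_le)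
qed

text \<open>The mirror image of the defining Pascal rule under k -> n + 1 - k. Expanding by one rule
  and then the other gives the same terms in either order.\<close>

lemma qbinom_Suc':
  "qbinom x (Suc n) k = x ^ nat (int n + 1 - k) * qbinom x n (k - 1) + qbinom x n k"
proof (induction n arbitrary: k)
  case 0
  show ?case by auto
next
  case (Suc n)
  \<comment> \<open>Both exponents equal n + 1 whenever the q-binomial is nonzero.\<close>
  have mid: "x ^ (nat k + nat (int n + 1 - k)) * qbinom x n (k - 1)
      = x ^ (nat (int n + 2 - k) + nat (k - 1)) * qbinom x n (k - 1)"
    by (rule power_mult_qbinom) linarith
  have "qbinom x (Suc (Suc n)) k = qbinom x (Suc n) (k - 1) + x ^ nat k * qbinom x (Suc n) k"
    by (rule qbinom.simps)
  also have "\<dots> = x ^ nat (int n + 2 - k) * qbinom x n (k - 2) + qbinom x n (k - 1)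
      + (x ^ (nat k + nat (int n + 1 - k)) * qbinom x n (k - 1) + x ^ nat k * qbinom x n k)"
    unfolding Suc.IH by (simp add: algebra_simps power_add)
  also have "\<dots> = x ^ nat (int n + 2 - k) * (qbinom x n (k - 2) + x ^ nat (k - 1) * qbinom x n (k - 1))
      + (qbinom x n (k - 1) + x ^ nat k * qbinom x n k)"
    unfolding mid by (simp add: algebra_simps power_add)
  also have "\<dots> = x ^ nat (int (Suc n) + 1 - k) * qbinom x (Suc n) (k - 1) + qbinom x (Suc n) k"
    by (simp add: algebra_simps)
  finally show ?case .
qed

text \<open>Equating the two Pascal rules relates [n choose k] to [n choose k-1]; substituting this
  into the defining rule leaves a single q-binomial.\<close>

lemma qbinom_absorb:
  assumes "1 \<le> k" "k \<le> int n + 1"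
  shows "(1 - x ^ nat k) * qbinom x (Suc n) k = (1 - x ^ Suc n) * qbinom x n (k - 1)"
proof -
  have *: "(1 - x ^ nat k) * qbinom x n k = (1 - x ^ nat (int n + 1 - k)) * qbinom x n (k - 1)"
    using qbinom_Suc'[of x n k] by (simp add: algebra_simps)
  have "nat k + nat (int n + 1 - k) = Suc n"
    using assms by linarith
  then have xn: "x ^ nat k * x ^ nat (int n + 1 - k) = x ^ Suc n"
    by (metis power_add)
  have "(1 - x ^ nat k) * qbinom x (Suc n) k
      = (1 - x ^ nat k) * qbinom x n (k - 1) + x ^ nat k * ((1 - x ^ nat k) * qbinom x n k)"
    by (simp add: algebra_simps)
  also have "\<dots> = (1 - x ^ nat k * x ^ nat (int n + 1 - k)) * qbinom x n (k - 1)"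
    unfolding * by (simp add: algebra_simps)
  finally show ?thesis unfolding xn .
qed

section \<open>Divisibility by q-integers\<close>

lemma monom_one_power: "Polynomial.monom (1 :: 'a::comm_semiring_1) 1 ^ n = Polynomial.monom 1 n"
  by (simp add: Polynomial.monom_power)

lemma q_int_add: "q_int (a + b) = q_int a + Polynomial.monom 1 a * q_int b"
  by (induction b) (simp_all add: q_int_def algebra_simps Polynomial.mult_monom)

lemma q_int_dvd_mult: "q_int a dvd q_int (a * b)"
  by (induction b) (simp_all add: q_int_add, simp add: q_int_def)

text \<open>[a]_q is a unit modulo [b]_q: if am = 1 + bc, then [am]_q = 1 + q [bc]_q, where [a]_q
  divides the left side and [b]_q divides [bc]_q. The cofactor \<open>A\<close> of [a]_q is thus its
  inverse.\<close>

lemma q_int_dvd_cancel: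
  assumes "coprime a b" and "q_int b dvd q_int a * f"
  shows "q_int b dvd f"
proof (cases "b = 0")
  case True
  then show ?thesis using assms by (simp add: q_int_def)
next
  case False
  show ?thesis
  proof (cases "b = 1")
    case True
    then show ?thesis by (simp add: q_int_def)
  next
    case b: False
    obtain m where m: "[a * m = 1] (mod b)"
      using assms(1) cong_solve_coprime_nat by auto
    \<comment> \<open>The residue of 1 is 1 only for b different from 1, hence the separate case
      above.\<close>
    then have "(a * m) mod b = 1"
      using b False by (simp add: cong_def)
    then have am: "a * m = 1 + b * (a * m div b)"
      by (metis add.commute mult_div_mod_eq)
    obtain A where A: "q_int (a * m) = q_int a * A"
      using q_int_dvd_mult by (rule dvdE)
    obtain C where C: "q_int (b * (a * m div b)) = q_int b * C"
      using q_int_dvd_mult by (rule dvdE)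
    have AC: "q_int a * A = 1 + Polynomial.monom 1 1 * (q_int b * C)"
      unfolding A[symmetric] C[symmetric] by (subst am, subst q_int_add) (simp add: q_int_def)
    have "q_int a * f * A - q_int b * (Polynomial.monom 1 1 * C * f)
        = f * (q_int a * A - Polynomial.monom 1 1 * (q_int b * C))"
      by (simp add: algebra_simps)
    also have "\<dots> = f"
      by (simp add: AC)
    finally have "f = q_int a * f * A - q_int b * (Polynomial.monom 1 1 * C * f)" ..
    then show ?thesis
      using assms(2) by (metis dvd_diff dvd_mult2 dvd_triv_left)
  qed
qed

text \<open>Absorption, after cancelling 1 - q, reads [k]_q [p choose k]_q = [p]_q
  [p-1 choose k-1]_q, and [k]_q can be cancelled modulo [p]_q since k is coprime to p.\<close>

lemma q_int_dvd_qbinom: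
  assumes "prime p" "0 < k" "k < int p"
  shows "q_int p dvd qbinom (Polynomial.monom 1 1) p k"
proof -
  let ?x = "Polynomial.monom 1 1 :: int poly"
  obtain n where n: "p = Suc n"
    using assms(1) prime_gt_0_nat gr0_implies_Suc by blast
  have geo: "1 - ?x ^ i = (1 - ?x) * q_int i" for i
    using q_int_geometric[of i] by (simp only: monom_one_power mult.commute)
  have "(1 - ?x ^ nat k) * qbinom ?x p k = (1 - ?x ^ p) * qbinom ?x n (k - 1)"
    unfolding n using assms n by (intro qbinom_absorb) auto
  then have "(1 - ?x) * (q_int (nat k) * qbinom ?x p k) = (1 - ?x) * (q_int p * qbinom ?x n (k - 1))"
    unfolding geo by (simp only: mult.assoc)
  moreover have "1 - ?x \<noteq> 0"
    by (simp add: Polynomial.monom_eq_1_iff)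
  ultimately have "q_int (nat k) * qbinom ?x p k = q_int p * qbinom ?x n (k - 1)"
    by simp
  moreover have "\<not> p dvd nat k"
    using assms by (auto dest!: dvd_imp_le)
  then have "coprime (nat k) p"
    using assms(1) prime_imp_coprime coprime_commute by blast
  ultimately show ?thesis
    by (metis dvd_triv_left q_int_dvd_cancel)
qed

section \<open>Schur's sum and its recurrence\<close>

text \<open>The generalized heptagonal numbers. They are non-negative integers for every integer
  \<open>j\<close>, so \<open>nat\<close> and \<open>div\<close> lose nothing.\<close>

definition schur_exp :: "int \<Rightarrow> nat" where
  "schur_exp j = nat (j * (5 * j - 3) div 2)"

lemma schur_exp: "2 * int (schur_exp j) = j * (5 * j - 3)"
proof -
  have "even (j * (5 * j - 3))" by auto
  moreover have "0 \<le> j * (5 * j - 3)"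
    by (cases "j \<le> 0") (auto simp: mult_nonpos_nonpos)
  ultimately show ?thesis by (simp add: schur_exp_def)
qed

lemma schur_exp_eqI: "j * (5 * j - 3) = 2 * int e \<Longrightarrow> schur_exp j = e"
  using schur_exp[of j] by simp

definition schur_coeff :: "'a::comm_ring_1 \<Rightarrow> int \<Rightarrow> 'a" where
  "schur_coeff x j = (-1) ^ nat \<bar>j\<bar> * x ^ schur_exp j"

definition schur_term :: "'a::comm_ring_1 \<Rightarrow> nat \<Rightarrow> int \<Rightarrow> 'a" where
  "schur_term x n j = schur_coeff x j * qbinom x n ((int n + 2 - 5 * j) div 2)"

text \<open>From n to n + 1 the floor in the lower index either rises by one or stays. Here it
  rises, and the defining Pascal rule gives the difference; in the odd case below it stays, and
  \<open>qbinom_Suc'\<close> does.\<close>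

lemma schur_term_diff_even:
  assumes "int n + 3 - 5 * j = 2 * k"
  shows "schur_term x (Suc n) j - schur_term x n j = schur_coeff x j * (x ^ nat k * qbinom x n k)"
proof -
  have k: "(int (Suc n) + 2 - 5 * j) div 2 = k" "(int n + 2 - 5 * j) div 2 = k - 1"
    using assms by presburger+
  show ?thesis unfolding schur_term_def k by (simp add: algebra_simps)
qed

lemma schur_term_diff_odd:
  assumes "int n + 2 - 5 * j = 2 * k"
  shows "schur_term x (Suc n) j - schur_term x n j
    = schur_coeff x j * (x ^ nat (int n + 1 - k) * qbinom x n (k - 1))"
proof -
  have k: "(int (Suc n) + 2 - 5 * j) div 2 = k" "(int n + 2 - 5 * j) div 2 = k"
    using assms by presburger+
  show ?thesis
    unfolding schur_term_def k qbinom_Suc' by (simp add: algebra_simps)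
qed

lemma neg_one_power_abs_Suc: "(-1 :: 'a::comm_ring_1) ^ nat \<bar>j + 1\<bar> = - ((-1) ^ nat \<bar>j\<bar>)"
  by (auto simp: minus_one_power_iff even_nat_iff)

text \<open>The telescoping certificate: its differences in \<open>j\<close> measure how far a
  single summand is from satisfying the recurrence of \<open>schur_fib\<close>.\<close>

definition schur_rest :: "'a::comm_ring_1 \<Rightarrow> nat \<Rightarrow> int \<Rightarrow> 'a" where
  "schur_rest x n j = (if even (int n + j)
     then schur_coeff x j * (x ^ nat ((int n + 4 - 5 * j) div 2) * qbinom x n ((int n + 4 - 5 * j) div 2))
     else 0)"

text \<open>By parity only one of the two \<open>schur_rest\<close> values can be nonzero. In each
  case one Pascal rule gives the difference of the terms and the other splits it into the multiple
  of \<open>schur_term x n j\<close> and that value.\<close>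

lemma schur_term_recurrence:
  "schur_term x (Suc (Suc n)) j - schur_term x (Suc n) j
    = x ^ Suc n * schur_term x n j + (schur_rest x n j - schur_rest x n (j + 1))"
proof (cases "even (int n + j)")
  case True
  define k where "k = (int n + 4 - 5 * j) div 2"
  have k: "int n + 4 - 5 * j = 2 * k" unfolding k_def using True by presburger
  then have k': "(int n + 2 - 5 * j) div 2 = k - 1" by presburger
  have p: "x ^ (nat k + nat (int n + 1 - k)) * qbinom x n (k - 1) = x ^ Suc n * qbinom x n (k - 1)"
    by (rule power_mult_qbinom) linarith
  have "schur_term x (Suc (Suc n)) j - schur_term x (Suc n) j
      = schur_coeff x j * (x ^ nat k * qbinom x (Suc n) k)"
    by (rule schur_term_diff_even) (use k in simp)
  also have "\<dots> = schur_coeff x j * (x ^ (nat k + nat (int n + 1 - k)) * qbinom x n (k - 1))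
      + schur_coeff x j * (x ^ nat k * qbinom x n k)"
    unfolding qbinom_Suc' by (simp add: algebra_simps power_add)
  also have "\<dots> = x ^ Suc n * schur_term x n j + schur_rest x n j"
    unfolding p schur_rest_def schur_term_def k' k_def[symmetric] using True
    by (simp add: algebra_simps)
  finally show ?thesis using True by (simp add: schur_rest_def)
next
  case False
  define k where "k = (int n + 3 - 5 * j) div 2"
  have k: "int n + 3 - 5 * j = 2 * k" unfolding k_def using False by presburger
  then have k': "(int n + 2 - 5 * j) div 2 = k - 1" "(int n + 4 - 5 * (j + 1)) div 2 = k - 2"
    by presburger+
  have p: "x ^ (nat (int n + 2 - k) + nat (k - 1)) * qbinom x n (k - 1) = x ^ Suc n * qbinom x n (k - 1)"
    by (rule power_mult_qbinom) linarith
  \<comment> \<open>The exponents agree because \<open>schur_exp\<close> grows by 5j + 1 from j to j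
    + 1, and n + 4 - 2k = 5j + 1.\<close>
  have r: "x ^ (schur_exp j + nat (int n + 2 - k)) * qbinom x n (k - 2)
      = x ^ (schur_exp (j + 1) + nat (k - 2)) * qbinom x n (k - 2)"
  proof (rule power_mult_qbinom)
    assume *: "0 \<le> k - 2" "k - 2 \<le> int n"
    have "2 * int (schur_exp (j + 1)) = 2 * int (schur_exp j) + 2 * (5 * j + 1)"
      unfolding schur_exp by (simp add: algebra_simps)
    then have "int (schur_exp j + nat (int n + 2 - k)) = int (schur_exp (j + 1) + nat (k - 2))"
      using * k by simp
    then show "schur_exp j + nat (int n + 2 - k) = schur_exp (j + 1) + nat (k - 2)"
      by (simp only: of_nat_eq_iff)
  qed
  have "schur_term x (Suc (Suc n)) j - schur_term x (Suc n) j
      = schur_coeff x j * (x ^ nat (int (Suc n) + 1 - k) * qbinom x (Suc n) (k - 1))"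
    by (rule schur_term_diff_odd) (use k in simp)
  also have "\<dots> = schur_coeff x j * (x ^ (nat (int n + 2 - k) + nat (k - 1)) * qbinom x n (k - 1))
      + (-1) ^ nat \<bar>j\<bar> * (x ^ (schur_exp j + nat (int n + 2 - k)) * qbinom x n (k - 2))"
    by (simp add: schur_coeff_def algebra_simps power_add)
  also have "\<dots> = x ^ Suc n * schur_term x n j - schur_rest x n (j + 1)"
    unfolding p r schur_rest_def schur_term_def k' schur_coeff_def neg_one_power_abs_Suc
    using False by (simp add: algebra_simps power_add)
  finally show ?thesis using False by (simp add: schur_rest_def)
qed

lemma sum_telescope_int:
  fixes f :: "int \<Rightarrow> 'a::ab_group_add"
  assumes "a \<le> b"
  shows "(\<Sum>j=a..<b. f j - f (j + 1)) = f a - f b"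
  using assms
proof (induction b rule: int_ge_induct)
  case (step i)
  then have "{a..<i + 1} = insert i {a..<i}" by auto
  then show ?case using step by simp
qed simp

lemma schur_rest_eq_0: "int n + 2 \<le> \<bar>j\<bar> \<Longrightarrow> schur_rest x n j = 0"
  by (subst schur_rest_def, subst qbinom_eq_0) (presburger, simp)

text \<open>The sum over all integers is cut to a window \<open>M\<close> that stays fixed in the
  induction, so the three sums in the recurrence have the same range.\<close>

lemma schur_fib_eq_sum:
  assumes "int n + 2 \<le> M"
  shows "schur_fib n = (\<Sum>j=-M..<M. schur_term (Polynomial.monom 1 1) n j)"
  using assms
proof (induction n rule: schur_fib.induct)
  case 1
  have "schur_term (Polynomial.monom 1 1 :: int poly) 0 j = 0" for j
  proof -
    \<comment> \<open>For n = 0 only lower index 0 contributes, which would need 5j = 2 or 5j =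
      1.\<close>
    have "(2 - 5 * j) div 2 \<noteq> 0" by presburger
    then show ?thesis by (simp add: schur_term_def)
  qed
  then show ?case by simp
next
  case 2
  have "schur_term (Polynomial.monom 1 1 :: int poly) (Suc 0) j = (if j = 0 then 1 else 0)" for j
  proof (cases "j = 0")
    case True
    then show ?thesis
      by (simp add: schur_term_def schur_coeff_def schur_exp_def)
  next
    case False
    then have "(int (Suc 0) + 2 - 5 * j) div 2 < 0 \<or> int (Suc 0) < (int (Suc 0) + 2 - 5 * j) div 2"
      by presburger
    then show ?thesis
      using False by (simp only: schur_term_def qbinom_eq_0) simp
  qed
  then show ?case using 2 by simp
next
  case (3 n)
  let ?x = "Polynomial.monom 1 1 :: int poly"
  let ?S = "\<lambda>n. \<Sum>j=-M..<M. schur_term ?x n j"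
  have "?S (Suc (Suc n)) - ?S (Suc n)
      = ?x ^ Suc n * ?S n + (\<Sum>j=-M..<M. schur_rest ?x n j - schur_rest ?x n (j + 1))"
    unfolding sum_subtractf[symmetric] schur_term_recurrence
    by (simp add: sum.distrib sum_distrib_left)
  \<comment> \<open>Both ends of the telescoped sum vanish, since there the lower index lies outside
    0..n.\<close>
  also have "(\<Sum>j=-M..<M. schur_rest ?x n j - schur_rest ?x n (j + 1)) = 0"
    using 3(3) by (subst sum_telescope_int) (simp_all add: schur_rest_eq_0)
  finally show ?case
    using 3 unfolding monom_one_power by simp
qed

section \<open>Reduction of F_p modulo [p]_q\<close>

lemma dvd_sum_diff_single:
  fixes f :: "'b \<Rightarrow> 'a::comm_ring_1"
  assumes "finite A" "a \<in> A" "\<And>j. j \<in> A \<Longrightarrow> j \<noteq> a \<Longrightarrow> h dvd f j"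
  shows "h dvd (\<Sum>j\<in>A. f j) - f a"
proof -
  have "(\<Sum>j\<in>A. f j) - f a = (\<Sum>j\<in>A - {a}. f j)"
    using assms by (simp add: sum.remove)
  then show ?thesis using assms by (auto intro!: dvd_sum)
qed

text \<open>Exponents of q count only modulo p, because [p]_q divides [mp]_q and hence 1 -
  q^(mp).\<close>

lemma q_int_dvd_monom_diff: "q_int p dvd Polynomial.monom 1 (a + m * p) - Polynomial.monom 1 a"
proof -
  have "q_int p dvd 1 - Polynomial.monom 1 (m * p)"
    using q_int_dvd_mult[of p m] q_int_geometric[of "p * m"]
    by (metis dvd_trans dvd_triv_left mult.commute)
  then have "q_int p dvd (- Polynomial.monom 1 a) * (1 - Polynomial.monom 1 (m * p))"
    by (rule dvd_mult)
  then show ?thesis by (simp add: algebra_simps Polynomial.mult_monom)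
qed


lemma q_int_dvd_schur_term:
  assumes "prime p" and "(int p + 2 - 5 * j) div 2 \<notin> {0, int p}"
  shows "q_int p dvd schur_term (Polynomial.monom 1 1) p j"
proof -
  let ?k = "(int p + 2 - 5 * j) div 2"
  consider "?k < 0 \<or> int p < ?k" | "0 < ?k" "?k < int p"
    using assms(2) by fastforce
  then have "q_int p dvd qbinom (Polynomial.monom 1 1) p ?k"
    by cases (simp_all only: qbinom_eq_0 dvd_0_right q_int_dvd_qbinom[OF assms(1)])
  then show ?thesis unfolding schur_term_def by (rule dvd_mult)
qed

text \<open>The four values are those of 5j for which the lower index is 0 or P (see
  \<open>schur_index_cases\<close>). Each forces a different residue of P modulo 5, so at most one
  is a multiple of 5.\<close>

lemma schur_index_unique:
  fixes P i j :: int
  assumes "5 * j \<in> {P + 2, P + 1, 2 - P, 1 - P}" "5 * i \<in> {P + 2, P + 1, 2 - P, 1 - P}"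
  shows "i = j"
proof -
  have "P mod 5 = 3 \<and> 5 * k = P + 2 \<or> P mod 5 = 4 \<and> 5 * k = P + 1
      \<or> P mod 5 = 2 \<and> 5 * k = 2 - P \<or> P mod 5 = 1 \<and> 5 * k = 1 - P"
    if "5 * k \<in> {P + 2, P + 1, 2 - P, 1 - P}" for k
  proof -
    have "5 * k = P + 2 \<Longrightarrow> P mod 5 = 3" "5 * k = P + 1 \<Longrightarrow> P mod 5 = 4"
      "5 * k = 2 - P \<Longrightarrow> P mod 5 = 2" "5 * k = 1 - P \<Longrightarrow> P mod 5 = 1"
      by presburger+
    then show ?thesis using that by blast
  qed
  from this[OF assms(1)] this[OF assms(2)] show ?thesis by auto
qed

text \<open>The analogue for the differences in \<open>schur_term_diff_even\<close>: there k = 0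
  means 5j = P + 3, and k = P means 5j = 3 - P.\<close>

lemma schur_index_diff_unique:
  fixes P i j :: int
  assumes "5 * j \<in> {P + 3, 3 - P}" "5 * i \<in> {P + 3, 3 - P}"
  shows "i = j"
proof -
  have "P mod 5 = 2 \<and> 5 * k = P + 3 \<or> P mod 5 = 3 \<and> 5 * k = 3 - P"
    if "5 * k \<in> {P + 3, 3 - P}" for k
  proof -
    have "5 * k = P + 3 \<Longrightarrow> P mod 5 = 2" "5 * k = 3 - P \<Longrightarrow> P mod 5 = 3"
      by presburger+
    then show ?thesis using that by blast
  qed
  from this[OF assms(1)] this[OF assms(2)] show ?thesis by auto
qed

lemma schur_index_cases:
  fixes P i :: int
  assumes "(P + 2 - 5 * i) div 2 \<in> {0, P}"
  shows "5 * i \<in> {P + 2, P + 1, 2 - P, 1 - P}"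
proof -
  have "(P + 2 - 5 * i) div 2 = 0 \<Longrightarrow> 5 * i = P + 2 \<or> 5 * i = P + 1"
    "(P + 2 - 5 * i) div 2 = P \<Longrightarrow> 5 * i = 2 - P \<or> 5 * i = 1 - P"
    by linarith+
  with assms show ?thesis by blast
qed

text \<open>The only surviving summand has q-binomial 1, leaving a signed power of q. The split
  \<open>t + m * p\<close> lets the exponent be reduced to \<open>t\<close>.\<close>

lemma schur_fib_prime_cong:
  assumes "prime p" "5 * j \<in> {int p + 2, int p + 1, 2 - int p, 1 - int p}"
    and e: "schur_exp j = t + m * p"
  shows "q_int p dvd schur_fib p - Polynomial.monom ((-1) ^ nat \<bar>j\<bar>) t"
proof -
  let ?x = "Polynomial.monom 1 1 :: int poly" and ?M = "int p + 2"
  have "q_int p dvd (\<Sum>i=-?M..<?M. schur_term ?x p i) - schur_term ?x p j"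
  proof (rule dvd_sum_diff_single)
    show "j \<in> {-?M..<?M}" using assms(2) prime_gt_0_nat[OF assms(1)] by auto
  next
    fix i assume "i \<noteq> j"
    then have "(int p + 2 - 5 * i) div 2 \<notin> {0, int p}"
      using schur_index_cases schur_index_unique[OF assms(2)] by metis
    then show "q_int p dvd schur_term ?x p i"
      by (rule q_int_dvd_schur_term[OF assms(1)])
  qed simp
  then have 1: "q_int p dvd schur_fib p - schur_term ?x p j"
    by (simp add: schur_fib_eq_sum[of p ?M])
  have "(int p + 2 - 5 * j) div 2 \<in> {0, int p}"
    using assms(2) by auto
  then have "schur_term ?x p j = (-1) ^ nat \<bar>j\<bar> * ?x ^ (t + m * p)"
    by (auto simp: schur_term_def schur_coeff_def e)
  then have "schur_term ?x p j = (-1) ^ nat \<bar>j\<bar> * Polynomial.monom 1 (t + m * p)"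
    by (simp only: monom_one_power)
  moreover have "Polynomial.monom ((-1) ^ nat \<bar>j\<bar>) t = (-1) ^ nat \<bar>j\<bar> * (Polynomial.monom 1 t :: int poly)"
    by (auto simp: minus_one_power_iff Polynomial.minus_monom)
  ultimately have "schur_fib p - Polynomial.monom ((-1) ^ nat \<bar>j\<bar>) t = (schur_fib p - schur_term ?x p j)
      + (-1) ^ nat \<bar>j\<bar> * (Polynomial.monom 1 (t + m * p) - Polynomial.monom 1 t)"
    by (simp add: algebra_simps)
  then show ?thesis
    using 1 q_int_dvd_monom_diff by (metis dvd_add dvd_mult)
qed

section \<open>Reduction of F_(p-1) modulo [p]_q\<close>

lemma q_int_dvd_schur_term_diff:
  assumes "prime p" "\<not> 5 dvd p" "5 * j \<notin> {int p + 3, 3 - int p}"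
  shows "q_int p dvd schur_term (Polynomial.monom 1 1) (Suc p) j - schur_term (Polynomial.monom 1 1) p j"
proof -
  have *: "q_int p dvd qbinom (Polynomial.monom 1 1) p k" if "k \<noteq> 0" "k \<noteq> int p" for k
    using q_int_dvd_qbinom[OF assms(1), of k] qbinom_eq_0[of k p "Polynomial.monom 1 1 :: int poly"] that
    by (cases "0 < k \<and> k < int p") auto
  show ?thesis
  proof (cases "even (int p + 3 - 5 * j)")
    case True
    then obtain k where k: "int p + 3 - 5 * j = 2 * k" by (rule evenE)
    show ?thesis
      unfolding schur_term_diff_even[OF k] using assms(3) k by (intro dvd_mult *) auto
  next
    case False
    then have "even (int p + 2 - 5 * j)" by presburger
    then obtain k where k: "int p + 2 - 5 * j = 2 * k" by (rule evenE)
    \<comment> \<open>Equality would mean 5j = p or 5j = -p.\<close>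
    have "k - 1 \<noteq> 0" "k - 1 \<noteq> int p"
      using k assms(2) by presburger+
    then show ?thesis
      unfolding schur_term_diff_odd[OF k] by (intro dvd_mult *)
  qed
qed

text \<open>The recurrence gives F_(p+1) - F_p = q^p F_(p-1), and q^p = 1 modulo [p]_q. The window p
  + 3 is the one that F_(p+1) requires.\<close>

lemma schur_fib_pred_prime_cong:
  assumes "prime p" "M = int p + 3"
  shows "q_int p dvd schur_fib (p - 1)
    - (\<Sum>j=-M..<M. schur_term (Polynomial.monom 1 1) (Suc p) j - schur_term (Polynomial.monom 1 1) p j)"
proof -
  obtain n where n: "p = Suc n"
    using assms(1) prime_gt_0_nat gr0_implies_Suc by blast
  have "(\<Sum>j=-M..<M. schur_term (Polynomial.monom 1 1 :: int poly) (Suc p) j - schur_term (Polynomial.monom 1 1) p j)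
      = Polynomial.monom 1 p * schur_fib (p - 1)"
    using schur_fib_eq_sum[of p M] schur_fib_eq_sum[of "Suc p" M] assms(2)
    by (simp add: sum_subtractf n)
  then have "schur_fib (p - 1)
      - (\<Sum>j=-M..<M. schur_term (Polynomial.monom 1 1) (Suc p) j - schur_term (Polynomial.monom 1 1) p j)
    = (1 - Polynomial.monom 1 p) * schur_fib (p - 1)"
    by (simp add: algebra_simps)
  then show ?thesis
    by (metis q_int_geometric dvd_mult2 dvd_triv_left)
qed

text \<open>Neither p + 3 nor 3 - p is a multiple of 5, so no difference survives.\<close>

lemma schur_fib_pred_prime_cong_0:
  assumes "prime p" "p mod 5 = 1 \<or> p mod 5 = 4"
  shows "q_int p dvd schur_fib (p - 1)"
proof -
  let ?M = "int p + 3"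
  have "5 * j \<notin> {int p + 3, 3 - int p}" for j
    using assms(2) by auto presburger+
  moreover have "\<not> 5 dvd p" using assms(2) by presburger
  ultimately have "q_int p dvd
      (\<Sum>j=-?M..<?M. schur_term (Polynomial.monom 1 1) (Suc p) j - schur_term (Polynomial.monom 1 1) p j)"
    using assms(1) by (intro dvd_sum q_int_dvd_schur_term_diff)
  then show ?thesis
    using schur_fib_pred_prime_cong[OF assms(1) refl] by (metis dvd_add diff_add_cancel)
qed

text \<open>Exactly one difference survives. Its sign is +1 as \<open>j\<close> is even, and its
  exponent is a multiple of p, so it reduces to 1.\<close>

lemma schur_fib_pred_prime_cong_1:
  assumes "prime p" "\<not> 5 dvd p" "5 * j \<in> {int p + 3, 3 - int p}" "even j"
    and e: "schur_exp j = m * p"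
  shows "q_int p dvd schur_fib (p - 1) - 1"
proof -
  let ?x = "Polynomial.monom 1 1 :: int poly" and ?M = "int p + 3"
  let ?u = "\<lambda>i. schur_term ?x (Suc p) i - schur_term ?x p i"
  have 1: "q_int p dvd (\<Sum>i=-?M..<?M. ?u i) - ?u j"
  proof (rule dvd_sum_diff_single)
    show "j \<in> {-?M..<?M}" using assms(3) prime_gt_0_nat[OF assms(1)] by auto
  next
    fix i assume "i \<noteq> j"
    then have "5 * i \<notin> {int p + 3, 3 - int p}"
      using schur_index_diff_unique[OF assms(3)] by metis
    then show "q_int p dvd ?u i"
      by (rule q_int_dvd_schur_term_diff[OF assms(1,2)])
  qed simp
  \<comment> \<open>\<open>k\<close> is 0 if 5j = p + 3, and p if 5j = 3 - p; \<open>l\<close> is 0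
    or 1 accordingly.\<close>
  obtain l k where k: "int p + 3 - 5 * j = 2 * k" "k = 0 \<or> k = int p" "nat k = l * p"
  proof -
    show thesis using that[of 0 0] that[of "int p" 1] assms(3) by auto
  qed
  have "?u j = ?x ^ ((m + l) * p)"
    unfolding schur_term_diff_even[OF k(1)] using k(2,3) assms(4)
    by (auto simp: schur_coeff_def e even_nat_iff minus_one_power_iff power_add algebra_simps)
  then have "?u j = Polynomial.monom 1 (0 + (m + l) * p)"
    by (simp only: monom_one_power add_0)
  then have "q_int p dvd ?u j - 1"
    using q_int_dvd_monom_diff[of p 0 "m + l"] by (simp only: Polynomial.monom_0 one_pCons)
  then have "q_int p dvd (schur_fib (p - 1) - sum ?u {-?M..<?M}) + (sum ?u {-?M..<?M} - ?u j) + (?u j - 1)"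
    using 1 schur_fib_pred_prime_cong[OF assms(1) refl] by (intro dvd_add)
  then show ?thesis by (simp add: algebra_simps)
qed

section \<open>The quadratic character of 5\<close>

lemma QuadRes_5_iff: "QuadRes 5 a \<longleftrightarrow> a mod 5 \<in> {0, 1, 4}"
proof
  assume "QuadRes 5 a"
  then obtain y where "y ^ 2 mod 5 = a mod 5"
    by (auto simp: QuadRes_def cong_def)
  then have "(y mod 5) ^ 2 mod 5 = a mod 5"
    by (simp add: power_mod)
  moreover have "y mod 5 \<in> {0, 1, 2, 3, 4}"
    by (simp, presburger)
  ultimately show "a mod 5 \<in> {0, 1, 4}"
    by auto
next
  assume "a mod 5 \<in> {0, 1, 4}"
  then have "(0::int) ^ 2 mod 5 = a mod 5 \<or> (1::int) ^ 2 mod 5 = a mod 5 \<or> (2::int) ^ 2 mod 5 = a mod 5"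
    by auto
  then show "QuadRes 5 a"
    unfolding QuadRes_def cong_def by blast
qed

lemma Legendre_5:
  assumes "prime p" "odd p" "p \<noteq> 5"
  shows "Legendre 5 (int p) = (if p mod 5 = 1 \<or> p mod 5 = 4 then 1 else - 1)"
proof -
  have "\<not> 5 dvd p"
    using assms primes_dvd_imp_eq[of 5 p] by auto
  moreover have "int p mod 5 = int (p mod 5)"
    by (simp add: zmod_int)
  ultimately have p5: "Legendre (int p) 5 = (if p mod 5 = 1 \<or> p mod 5 = 4 then 1 else - 1)"
    unfolding Legendre_def QuadRes_5_iff cong_def by (auto simp: dvd_eq_mod_eq_0)
  have "2 < p"
    using assms prime_ge_2_nat[of p] by (cases "p = 2") auto
  \<comment> \<open>The reciprocity sign is +1 because (5 - 1)/2 is even, so the two symbols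
    agree.\<close>
  then have "Legendre (int 5) (int p) * Legendre (int p) (int 5) = (-1) ^ ((5 - 1) div 2 * ((p - 1) div 2))"
    using assms by (intro Quadratic_Reciprocity) auto
  then have "Legendre 5 (int p) * Legendre (int p) 5 = 1"
    by (simp add: power_mult)
  then show ?thesis
    unfolding p5 by (auto split: if_splits)
qed

section \<open>The residue classes of p modulo 10\<close>

theorem theorem1p2:
  fixes p \<alpha> :: nat
  assumes "prime p" and "odd p" and "p \<noteq> 5"
    and "1 \<le> \<alpha>" and "\<alpha> \<le> 4" and "[\<alpha> * p = 1] (mod 5)"
  shows "poly_cong (schur_fib (p - 1)) [:(1 - Legendre 5 (int p)) div 2:] (q_int p) \<and>
         poly_cong (schur_fib p) (Polynomial.monom (Legendre 5 (int p)) ((\<alpha> * p - 1) div 5)) (q_int p)"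
proof -
  have n5: "\<not> 5 dvd p"
    using assms(1,3) primes_dvd_imp_eq[of 5 p] by auto
  define m where "m = p div 10"
  have \<alpha>: "\<alpha> = 1 \<or> \<alpha> = 2 \<or> \<alpha> = 3 \<or> \<alpha> = 4" using assms(4,5) by auto
  have "(\<alpha> * (p mod 10 mod 5)) mod 5 = 1"
    using assms(6) by (simp add: cong_def mod_mod_cancel mod_mult_right_eq)
  then have "(\<alpha> * (p mod 10)) mod 5 = 1"
    by (simp only: mod_mult_right_eq)
  moreover have "p mod 10 = 1 \<or> p mod 10 = 3 \<or> p mod 10 = 5 \<or> p mod 10 = 7 \<or> p mod 10 = 9"
    using assms(2) by presburger
  \<comment> \<open>The congruence excludes residue 5 and makes \<alpha> the inverse of p modulo
    5.\<close>
  ultimately have "p mod 10 = 1 \<and> \<alpha> = 1 \<or> p mod 10 = 3 \<and> \<alpha> = 2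
      \<or> p mod 10 = 7 \<and> \<alpha> = 3 \<or> p mod 10 = 9 \<and> \<alpha> = 4"
    using \<alpha> by auto
  moreover have "p = 10 * m + p mod 10"
    by (simp add: m_def)
  ultimately consider "p = 10 * m + 1" "\<alpha> = 1" | "p = 10 * m + 3" "\<alpha> = 2"
    | "p = 10 * m + 7" "\<alpha> = 3" | "p = 10 * m + 9" "\<alpha> = 4"
    by metis
  then show ?thesis
  proof cases
    case 1
    \<comment> \<open>Surviving index for F_p: j = (1 - p)/5.\<close>
    have "schur_exp (- 2 * int m) = 2 * m + m * p"
      by (rule schur_exp_eqI) (simp add: 1(1) algebra_simps)
    then have "q_int p dvd schur_fib p - Polynomial.monom ((-1) ^ nat \<bar>- 2 * int m\<bar>) (2 * m)"
      using 1(1) by (intro schur_fib_prime_cong[OF assms(1)]) auto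
    moreover have "(-1::int) ^ nat \<bar>- 2 * int m\<bar> = 1"
      by (simp add: minus_one_power_iff even_nat_iff)
    moreover have "p mod 5 = 1" using 1(1) by presburger
    then have "Legendre 5 (int p) = 1" "q_int p dvd schur_fib (p - 1)"
      using schur_fib_pred_prime_cong_0[OF assms(1)] by (simp_all add: Legendre_5[OF assms(1-3)])
    moreover have "(\<alpha> * p - 1) div 5 = 2 * m" using 1 by simp
    ultimately show ?thesis by (simp add: poly_cong_def)
  next
    case 2
    \<comment> \<open>Surviving index for F_p: j = (p + 2)/5.\<close>
    have "schur_exp (2 * int m + 1) = 4 * m + 1 + m * p"
      by (rule schur_exp_eqI) (simp add: 2(1) algebra_simps)
    then have "q_int p dvd schur_fib p - Polynomial.monom ((-1) ^ nat \<bar>2 * int m + 1\<bar>) (4 * m + 1)"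
      using 2(1) by (intro schur_fib_prime_cong[OF assms(1)]) auto
    moreover have "(-1::int) ^ nat \<bar>2 * int m + 1\<bar> = -1"
      by (simp add: minus_one_power_iff even_nat_iff)
    \<comment> \<open>Surviving index for F_(p-1): j = (3 - p)/5.\<close>
    moreover have "schur_exp (- 2 * int m) = m * p"
      by (rule schur_exp_eqI) (simp add: 2(1) algebra_simps)
    then have "q_int p dvd schur_fib (p - 1) - 1"
      by (rule schur_fib_pred_prime_cong_1[OF assms(1) n5, rotated 2]) (use 2(1) in auto)
    moreover have "p mod 5 = 3" using 2(1) by presburger
    then have "Legendre 5 (int p) = -1" by (simp add: Legendre_5[OF assms(1-3)])
    moreover have "(\<alpha> * p - 1) div 5 = 4 * m + 1" using 2 by simp
    ultimately show ?thesis by (simp add: poly_cong_def one_pCons)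
  next
    case 3
    \<comment> \<open>Surviving index for F_p: j = (2 - p)/5.\<close>
    have "schur_exp (- 2 * int m - 1) = 6 * m + 4 + m * p"
      by (rule schur_exp_eqI) (simp add: 3(1) algebra_simps)
    then have "q_int p dvd schur_fib p - Polynomial.monom ((-1) ^ nat \<bar>- 2 * int m - 1\<bar>) (6 * m + 4)"
      using 3(1) by (intro schur_fib_prime_cong[OF assms(1)]) auto
    moreover have "(-1::int) ^ nat \<bar>- 2 * int m - 1\<bar> = -1"
      by (simp add: minus_one_power_iff even_nat_iff)
    \<comment> \<open>Surviving index for F_(p-1): j = (p + 3)/5.\<close>
    moreover have "schur_exp (2 * int m + 2) = (m + 1) * p"
      by (rule schur_exp_eqI) (simp add: 3(1) algebra_simps)
    then have "q_int p dvd schur_fib (p - 1) - 1"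
      by (rule schur_fib_pred_prime_cong_1[OF assms(1) n5, rotated 2]) (use 3(1) in auto)
    moreover have "p mod 5 = 2" using 3(1) by presburger
    then have "Legendre 5 (int p) = -1" by (simp add: Legendre_5[OF assms(1-3)])
    moreover have "(\<alpha> * p - 1) div 5 = 6 * m + 4" using 3 by simp
    ultimately show ?thesis by (simp add: poly_cong_def one_pCons)
  next
    case 4
    \<comment> \<open>Surviving index for F_p: j = (p + 1)/5.\<close>
    have "schur_exp (2 * int m + 2) = 8 * m + 7 + m * p"
      by (rule schur_exp_eqI) (simp add: 4(1) algebra_simps)
    then have "q_int p dvd schur_fib p - Polynomial.monom ((-1) ^ nat \<bar>2 * int m + 2\<bar>) (8 * m + 7)"
      using 4(1) by (intro schur_fib_prime_cong[OF assms(1)]) auto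
    moreover have "(-1::int) ^ nat \<bar>2 * int m + 2\<bar> = 1"
      by (simp add: minus_one_power_iff even_nat_iff)
    moreover have "p mod 5 = 4" using 4(1) by presburger
    then have "Legendre 5 (int p) = 1" "q_int p dvd schur_fib (p - 1)"
      using schur_fib_pred_prime_cong_0[OF assms(1)] by (simp_all add: Legendre_5[OF assms(1-3)])
    moreover have "(\<alpha> * p - 1) div 5 = 8 * m + 7" using 4 by simp
    ultimately show ?thesis by (simp add: poly_cong_def)
  qed
qed

end
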